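(* Let $A\in\mathbb{C}^{n\times n}$ be a diagonalizable matrix with eigenvalues $\lambda_1,\dots,\lambda_n$ satisfying $|\lambda_1|>|\lambda_2|\ge\cdots\ge|\lambda_n|$, and let $\phi_1,\dots,\phi_n$ be the corresponding normalized eigenvectors (a basis of $\mathbb{C}^n$ with $\|\phi_j\|_2=1$). Assume that $\lambda_*\in\mathbb{C}$ is given such that $|\lambda_*|<|\lambda_1|$ and $$\lambda_2,\dots,\lambda_n\in\lambda_*\Gamma=\{\lambda_* z\in\mathbb{C}: z\in\Gamma\},$$ where $\Gamma$ is the closed deltoid region defined in the context. Let $v_0\in\mathbb{R}^n$ be an initial vector with eigenbasis expansion $v_0=\sum_{j=1}^n a_j\phi_j$. Run the Deltoid Momentum Power Method (defined in the context) with inputs $A$, $v_0$, $\beta=4\lambda_*^3/27$, and $N$. Then the output $x_N$ satisfies $$\min_{\theta\in[0,2\pi)}\|x_N-e^{i\theta}\phi_1\|_2=\mathcal{O}\left(\left(1+\sqrt{\left|\frac{\lambda_1}{\lambda_*}\right|-1}\right)^{-N}\right)$$ as $N\to\infty$, where the implied constant in the big-$\mathcal{O}$ only depends on $a_1,\dots,a_n$.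
   Context: The deltoid curve $\gamma\subset\mathbb{C}$ is the closed curve $\gamma(t)=\frac23e^{it}+\frac13e^{-2it}$, $t\in[0,2\pi]$, and $\Gamma$ is the closure of the region enclosed by $\gamma$. $\|\cdot\|_2$ is the Euclidean norm on $\mathbb{C}^n$. Deltoid Momentum Power Method, with inputs a matrix $A$, a vector $v_0\in\mathbb{R}^n$, a parameter $\beta\in\mathbb{C}$, and $N\in\mathbb{N}$. Initialization (two power iterations with the matrix $\frac23A$ started from $v_0$): set $h_0=\|v_0\|_2$, $x_0=h_0^{-1}v_0$; for $k=0,1$ set $u_{k+1}=\frac23Ax_k$, $h_{k+1}=\|u_{k+1}\|_2$, $x_{k+1}=h_{k+1}^{-1}u_{k+1}$. Then for $k=2,\dots,N-1$ set $$u_{k+1}=Ax_k-\frac{\beta}{h_kh_{k-1}}x_{k-2},\qquad h_{k+1}=\|u_{k+1}\|_2,\qquad x_{k+1}=h_{k+1}^{-1}u_{k+1}.$$ The output is $x_N$.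
   Formalization: The formal theorem adds a_1 ≠ 0 (otherwise false: A = diag(2,1), λ_* = 1, v_0 = e_2 gives x_N = e_2 for all N, at distance √2) and λ_* ≠ 0 (otherwise λ_1/λ_* is undefined). *)

theory Defs
  imports "HOL-Analysis.Analysis"
begin

definition deltoid :: "real \<Rightarrow> complex" where
  "deltoid t = 2/3 * exp (\<i> * of_real t) + 1/3 * exp (- 2 * \<i> * of_real t)"

definition deltoid_region :: "complex set" where
  "deltoid_region = closure (inside (deltoid ` {0..2*pi}))"

definition complex_vec :: "real ^ 'n \<Rightarrow> complex ^ 'n" where
  "complex_vec v = (\<chi> i. complex_of_real (v $ i))"

text \<open>
  The unnormalised iterates \<open>u\<^sub>k\<close>, with the convention \<open>u\<^sub>0 = v\<^sub>0\<close>, so that \<open>h\<^sub>k = norm u\<^sub>k\<close> and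
  \<open>x\<^sub>k = sgn u\<^sub>k\<close> for every \<open>k\<close> (recall \<open>sgn u = u /\<^sub>R norm u\<close>).
\<close>

fun dmpm_u :: "complex ^ 'n ^ 'n \<Rightarrow> real ^ 'n \<Rightarrow> complex \<Rightarrow> nat \<Rightarrow> complex ^ 'n" where
  "dmpm_u A v\<^sub>0 \<beta> 0 = complex_vec v\<^sub>0"
| "dmpm_u A v\<^sub>0 \<beta> (Suc 0) = ((2/3) *\<^sub>R A) *v sgn (dmpm_u A v\<^sub>0 \<beta> 0)"
| "dmpm_u A v\<^sub>0 \<beta> (Suc (Suc 0)) = ((2/3) *\<^sub>R A) *v sgn (dmpm_u A v\<^sub>0 \<beta> (Suc 0))"
| "dmpm_u A v\<^sub>0 \<beta> (Suc (Suc (Suc k))) =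
     A *v sgn (dmpm_u A v\<^sub>0 \<beta> (Suc (Suc k)))
     - (\<beta> / complex_of_real
            (norm (dmpm_u A v\<^sub>0 \<beta> (Suc (Suc k))) * norm (dmpm_u A v\<^sub>0 \<beta> (Suc k))))
       *s sgn (dmpm_u A v\<^sub>0 \<beta> k)"

definition dmpm :: "complex ^ 'n ^ 'n \<Rightarrow> real ^ 'n \<Rightarrow> complex \<Rightarrow> nat \<Rightarrow> complex ^ 'n" where
  "dmpm A v\<^sub>0 \<beta> N = sgn (dmpm_u A v\<^sub>0 \<beta> N)"

text \<open>
  \<open>A\<close> is diagonalizable, with eigenvalues \<open>lam 1, \<dots>, lam n\<close> (listed with multiplicity) and a
  corresponding basis of normalised eigenvectors \<open>phi 1, \<dots>, phi n\<close>, where \<open>n = CARD('n)\<close>. The values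
  of \<open>lam\<close> and \<open>phi\<close> outside \<open>{1..n}\<close> are irrelevant.
\<close>

definition diagonalized_by ::
  "complex ^ 'n ^ 'n \<Rightarrow> (nat \<Rightarrow> complex) \<Rightarrow> (nat \<Rightarrow> complex ^ 'n) \<Rightarrow> bool" where
  "diagonalized_by A lam phi \<longleftrightarrow>
     (\<forall>j\<in>{1..CARD('n)}. A *v phi j = lam j *s phi j \<and> norm (phi j) = 1) \<and>
     inj_on phi {1..CARD('n)} \<and>
     vec.independent (phi ` {1..CARD('n)}) \<and>
     vec.span (phi ` {1..CARD('n)}) = UNIV"

text \<open>The infimum is a minimum by \<open>phase_dist_attained\<close> below.\<close>

definition phase_dist :: "complex ^ 'n \<Rightarrow> complex ^ 'n \<Rightarrow> real" where
  "phase_dist x y = (INF \<theta>\<in>{0..<2*pi}. norm (x - exp (\<i> * complex_of_real \<theta>) *s y))"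

lemma phase_dist_attained:
  "\<exists>\<theta>\<in>{0..<2*pi}. phase_dist x y = norm (x - exp (\<i> * complex_of_real \<theta>) *s y) \<and>
     (\<forall>\<theta>'\<in>{0..<2*pi}. phase_dist x y \<le> norm (x - exp (\<i> * complex_of_real \<theta>') *s y))"
proof -
  define f where "f = (\<lambda>\<theta>. norm (x - exp (\<i> * complex_of_real \<theta>) *s y))"
  have "continuous_on {0..2*pi} f"
    unfolding f_def vector_scalar_mult_def by (intro continuous_intros)
  then obtain t where t: "t \<in> {0..2*pi}" "\<And>s. s \<in> {0..2*pi} \<Longrightarrow> f t \<le> f s"
    using continuous_attains_inf[of "{0..2*pi}" f] by fastforce
  have per: "f (2*pi) = f 0"
    unfolding f_def by (simp add: exp_eq_polar[symmetric] exp_Euler)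
  define t' where "t' = (if t = 2*pi then 0 else t)"
  have t': "t' \<in> {0..<2*pi}" "f t' = f t"
    using t(1) per by (auto simp: t'_def)
  have min: "f t' \<le> f s" if "s \<in> {0..<2*pi}" for s
    using t(2)[of s] t'(2) that by auto
  have "phase_dist x y = f t'"
    unfolding phase_dist_def f_def[symmetric] using t'(1) min
    by (intro cInf_eq_minimum) (auto simp: f_def)
  then show ?thesis
    using t'(1) min unfolding f_def by auto
qed

end

theory Submission
  imports Defs "HOL-Computational_Algebra.Fundamental_Theorem_Algebra"
begin

text \<open>
  Up to a positive factor the iterates are \<open>V\<^sub>k = \<Sum>\<^sub>j a\<^sub>j (2\<lambda>\<^sub>*/3)\<^sup>k P\<^sub>k(\<lambda>\<^sub>j/\<lambda>\<^sub>*) \<phi>\<^sub>j\<close>, where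
  \<open>P\<^sub>0, P\<^sub>1, P\<^sub>2 = 1, z, z\<^sup>2\<close> and \<open>P\<^sub>k\<^sub>+\<^sub>3 = 3/2 z P\<^sub>k\<^sub>+\<^sub>2 - 1/2 P\<^sub>k\<close>. The roots of the characteristic
  polynomial \<open>w\<^sup>3 - 3/2 z w\<^sup>2 + 1/2\<close> are the preimages of \<open>z\<close> under \<open>f(w) = 2/3 w + 1/3 w\<^sup>-\<^sup>2\<close>, which
  maps the unit circle onto the deltoid.

  Inside the deltoid all three roots lie in the closed unit disc, because \<open>f\<close> maps the exterior of
  the disc to a connected unbounded set that misses the deltoid. Expressing \<open>P\<^sub>k\<close> by power sums of
  the roots bounds it by \<open>3/2\<close>, without any case distinction for multiple roots (the cusps).

  For \<open>|z| \<ge> y\<close> the ratio \<open>|P\<^sub>k\<^sub>+\<^sub>1(z)| / |P\<^sub>k(z)|\<close> dominates \<open>P\<^sub>k\<^sub>+\<^sub>1(y) / P\<^sub>k(y)\<close> by induction on \<open>k\<close>, which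
  reduces lower bounds outside the unit disc to positive reals. There \<open>P\<^sub>k(f(w)) \<ge> 4/9 w\<^sup>k\<close> for
  \<open>w \<ge> 1\<close>, and \<open>w = 1 + \<surd>(|z| - 1)\<close> satisfies \<open>f(w) \<le> |z|\<close>.
\<close>

section \<open>Scaled recurrence polynomials and their lower bound outside the unit disc\<close>

fun deltoid_poly :: "'a::real_normed_field \<Rightarrow> nat \<Rightarrow> 'a" where
  "deltoid_poly z 0 = 1"
| "deltoid_poly z (Suc 0) = z"
| "deltoid_poly z (Suc (Suc 0)) = z\<^sup>2"
| "deltoid_poly z (Suc (Suc (Suc k))) = 3/2 * z * deltoid_poly z (Suc (Suc k)) - deltoid_poly z k / 2"

definition deltoid_map :: "'a::real_normed_field \<Rightarrow> 'a" where
  "deltoid_map w = 2/3 * w + 1/3 / w\<^sup>2"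

lemma nat_induct3:
  assumes "P 0" "P (Suc 0)" "P (Suc (Suc 0))"
    and "\<And>k. P k \<Longrightarrow> P (Suc k) \<Longrightarrow> P (Suc (Suc k)) \<Longrightarrow> P (Suc (Suc (Suc k)))"
  shows "P n"
proof -
  have "P n \<and> P (Suc n) \<and> P (Suc (Suc n))" by (induction n) (use assms in auto)
  then show ?thesis ..
qed

lemma deltoid_poly_deltoid_map_ge:
  fixes w :: real
  assumes "w \<ge> 1"
  shows "deltoid_poly (deltoid_map w) k \<ge> 4/9 * w ^ k"
proof -
  \<comment> \<open>\<open>c\<close> is the coefficient of \<open>w ^ k\<close> in the solution of the recurrence. The remainder \<open>E\<close> only
    involves the other two roots, whose quadratic recurrence has positive coefficients.\<close>
  define c where "c = (8 + 1 / w^3) / 18"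
  define E where "E k = deltoid_poly (deltoid_map w) k - c * w ^ k" for k
  have w: "w > 0" using assms by simp
  have c: "c \<ge> 4/9" "c \<le> 1/2"
    using assms one_le_power[OF assms, of 3] by (auto simp: c_def field_simps)
  have E0: "E 0 \<ge> 0" using c by (simp add: E_def)
  have "c * w \<le> 1/2 * w" using c w by (intro mult_right_mono) auto
  also have "\<dots> \<le> deltoid_map w" using w by (simp add: deltoid_map_def field_simps)
  finally have E1: "E 1 \<ge> 0" by (simp add: E_def)
  have rec: "E (Suc (Suc k)) = 1 / (2 * w\<^sup>2) * E (Suc k) + 1 / (2 * w) * E k" for k
  proof (induction k)
    case 0
    \<comment> \<open>This identity fixes the value of \<open>c\<close>: for \<open>w > 1\<close> no
      other value satisfies it.\<close>
    show ?case using w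
      by (simp add: E_def c_def deltoid_map_def field_simps power2_eq_square power3_eq_cube)
  next
    case (Suc k)
    have e: "E (Suc (Suc (Suc k))) = 3/2 * deltoid_map w * E (Suc (Suc k)) - E k / 2"
      using w by (simp add: E_def deltoid_map_def field_simps power2_eq_square power3_eq_cube)
    \<comment> \<open>Solving the induction hypothesis for \<open>E k\<close> eliminates it from the
      cubic recurrence. What remains is the factor t^2 - t/(2w^2) - 1/(2w) of the characteristic
      polynomial.\<close>
    have "E k = 2 * w * E (Suc (Suc k)) - 1 / w * E (Suc k)"
      unfolding Suc using w by (simp add: distrib_left power2_eq_square)
    then show ?case unfolding e deltoid_map_def using w
      by (simp only:) (simp add: field_simps power2_eq_square)
  qed
  have "E k \<ge> 0 \<and> E (Suc k) \<ge> 0"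
  proof (induction k)
    case 0 then show ?case using E0 E1 by simp
  next
    case (Suc k) then show ?case using w by (simp only: rec) auto
  qed
  then have "c * w ^ k \<le> deltoid_poly (deltoid_map w) k" by (simp add: E_def)
  moreover have "4/9 * w ^ k \<le> c * w ^ k" using c w by (intro mult_right_mono) auto
  ultimately show ?thesis by linarith
qed

text \<open>Write P(k+3)/P(k+2) = 3/2 z - (P(k)/P(k+2))/2: larger earlier ratios shrink the
  subtracted term, so the triangle inequality preserves the comparison of ratios. It is proved in
  cross-multiplied form because \<open>deltoid_poly z k\<close> is not known in advance to be
  nonzero.\<close>

lemma norm_deltoid_poly_mono:
  fixes z :: "'a::real_normed_field" and y :: real
  assumes "y \<le> norm z" "\<And>k. deltoid_poly y k > 0"
  shows "deltoid_poly y k \<le> norm (deltoid_poly z k)"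
proof -
  have step: "deltoid_poly y (Suc k) * norm (deltoid_poly z k)
      \<le> norm (deltoid_poly z (Suc k)) * deltoid_poly y k" for k
  proof (induction k rule: induct_nat_012)
    case 0
    show ?case using assms(1) by simp
  next
    case 1
    have "y > 0" using assms(2)[of 1] by simp
    then have "y * norm z * y \<le> norm z * norm z * y"
      using assms(1) by (intro mult_right_mono) auto
    then have "y\<^sup>2 * norm z \<le> norm (z\<^sup>2) * y"
      by (simp only: power2_eq_square norm_mult ac_simps)
    then show ?case by simp
  next
    case (ge2 j)
    define p q where "p i = deltoid_poly y (i + j)" and "q i = norm (deltoid_poly z (i + j))" for i
    have pos: "p i > 0" for i using assms(2) by (simp add: p_def)
    have q0: "q i \<ge> 0" for i by (simp add: q_def)
    have "q 1 * p 0 \<ge> p 1 * q 0" "q 2 * p 1 \<ge> p 2 * q 1"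
      using ge2 by (simp_all add: p_def q_def numeral_2_eq_2)
    \<comment> \<open>Chaining the two hypotheses through \<open>p 2 * q 1 * p 0\<close>; the common
      factor \<open>p 1\<close> then cancels.\<close>
    then have "p 1 * (q 2 * p 0) \<ge> p 1 * (p 2 * q 0)"
      using pos by (smt (verit, best) mult.commute mult.left_commute mult_left_mono)
    then have a: "q 2 * p 0 \<ge> p 2 * q 0" using pos by simp
    have "norm (deltoid_poly z (3 + j))
        \<ge> norm (3/2 * z * deltoid_poly z (2 + j)) - norm (deltoid_poly z j / 2)"
      unfolding numeral_3_eq_3 numeral_2_eq_2 add_Suc add_0 deltoid_poly.simps
      by (rule norm_triangle_ineq2)
    then have "q 3 \<ge> 3/2 * norm z * q 2 - q 0 / 2"
      by (simp add: q_def norm_mult norm_divide)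
    moreover have "3/2 * norm z * q 2 \<ge> 3/2 * y * q 2"
      using assms(1) q0 by (intro mult_right_mono) auto
    ultimately have "q 3 \<ge> 3/2 * y * q 2 - q 0 / 2" by linarith
    then have "q 3 * p 2 \<ge> (3/2 * y * q 2 - q 0 / 2) * p 2"
      using pos[of 2] by (intro mult_right_mono) auto
    moreover have "p 3 * q 2 = (3/2 * y * p 2 - p 0 / 2) * q 2"
      by (simp add: p_def numeral_3_eq_3)
    ultimately have "q 3 * p 2 \<ge> p 3 * q 2" using a by (simp add: algebra_simps)
    then show ?case by (simp add: p_def q_def numeral_3_eq_3)
  qed
  show ?thesis
  proof (induction k)
    case (Suc k)
    have "deltoid_poly y (Suc k) * deltoid_poly y k
        \<le> deltoid_poly y (Suc k) * norm (deltoid_poly z k)"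
      using Suc assms(2) by (simp add: less_imp_le)
    also note step
    finally show ?case using assms(2) by simp
  qed simp
qed

lemma norm_deltoid_poly_ge:
  fixes z :: "'a::real_normed_field"
  assumes "norm z \<ge> 1"
  shows "norm (deltoid_poly z k) \<ge> 4/9 * (1 + sqrt (norm z - 1)) ^ k"
proof -
  define s where "s = sqrt (norm z - 1)"
  have s: "s \<ge> 0" "norm z = 1 + s\<^sup>2" using assms by (auto simp: s_def)
  \<comment> \<open>This is f(1+s) <= 1+s^2 with denominators cleared. The square root arises
    because f has a critical point at 1, with f(1+s) = 1 + s^2 + O(s^3).\<close>
  have "3 * (1 + s)\<^sup>2 * (1 + s\<^sup>2) - (2 * (1 + s) ^ 3 + 1) = 4 * s ^ 3 + 3 * s ^ 4"
    by (simp add: power2_eq_square power3_eq_cube power4_eq_xxxx algebra_simps)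
  then have "2 * (1 + s) ^ 3 + 1 \<le> 3 * (1 + s)\<^sup>2 * (1 + s\<^sup>2)"
    using s by (smt (verit) zero_le_power)
  then have "(2 * (1 + s) ^ 3 + 1) / (3 * (1 + s)\<^sup>2) \<le> norm z"
    using s by (simp add: divide_le_eq mult.commute)
  moreover have "deltoid_map (1 + s) = (2 * (1 + s) ^ 3 + 1) / (3 * (1 + s)\<^sup>2)"
    using s by (simp add: deltoid_map_def divide_simps)
      (simp add: algebra_simps power2_eq_square power3_eq_cube)
  ultimately have "deltoid_map (1 + s) \<le> norm z" by simp
  moreover have g: "deltoid_poly (deltoid_map (1 + s)) k \<ge> 4/9 * (1 + s) ^ k" for k
    using s by (intro deltoid_poly_deltoid_map_ge) auto
  moreover have "deltoid_poly (deltoid_map (1 + s)) k > 0" for k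
    using g[of k] s by (smt (verit) divide_pos_pos mult_pos_pos zero_less_power)
  ultimately have "deltoid_poly (deltoid_map (1 + s)) k \<le> norm (deltoid_poly z k)"
    by (intro norm_deltoid_poly_mono)
  with g[of k] show ?thesis unfolding s_def by linarith
qed

section \<open>Upper bound on the closed deltoid region\<close>

lemma deltoid_poly_power_sums:
  fixes x y w z :: complex
  assumes e: "x + y + w = 3/2 * z" "x * y + y * w + w * x = 0" "x * y * w = - (1/2)"
  shows "deltoid_poly z (k + 3) =
    4/9 * (x ^ (k+3) + y ^ (k+3) + w ^ (k+3)) + 1/18 * (x ^ k + y ^ k + w ^ k)"
proof -
  define s where "s k = x ^ k + y ^ k + w ^ k" for k
  have cub: "v ^ 3 = 3/2 * z * v\<^sup>2 - 1/2" if "v \<in> {x,y,w}" for v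
  proof -
    have "(v - x) * (v - y) * (v - w) = 0" using that by auto
    then have "v ^ 3 - (x + y + w) * v\<^sup>2 + (x * y + y * w + w * x) * v - x * y * w = 0"
      by (simp add: power2_eq_square power3_eq_cube algebra_simps)
    then show ?thesis unfolding e by (simp add: algebra_simps)
  qed
  have pw: "v ^ (k + 3) = 3/2 * z * v ^ (k+2) - 1/2 * v ^ k" if "v \<in> {x,y,w}" for v k
    unfolding power_add cub[OF that] by (simp add: algebra_simps)
  have rec: "s (k + 3) = 3/2 * z * s (k+2) - 1/2 * s k" for k
  proof -
    have "s (k + 3) = (3/2 * z * x ^ (k+2) - 1/2 * x ^ k) + (3/2 * z * y ^ (k+2) - 1/2 * y ^ k)
        + (3/2 * z * w ^ (k+2) - 1/2 * w ^ k)"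
      unfolding s_def using pw by simp
    then show ?thesis by (simp add: s_def algebra_simps)
  qed
  have s0: "s 0 = 3" and s1: "s 1 = 3/2 * z" using e by (auto simp: s_def)
  have "s 2 = (x + y + w)\<^sup>2 - 2 * (x * y + y * w + w * x)"
    by (simp add: s_def power2_eq_square algebra_simps)
  then have s2: "s 2 = 9/4 * z\<^sup>2" unfolding e by (simp add: power2_eq_square)
  have s3: "s 3 = 3/2 * z * s 2 - 1/2 * s 0" using rec[of 0] by (simp add: numeral_2_eq_2)
  have s4: "s 4 = 3/2 * z * s 3 - 1/2 * s 1" using rec[of 1] by (simp add: eval_nat_numeral)
  have s5: "s 5 = 3/2 * z * s 4 - 1/2 * s 2" using rec[of 2] by simp
  \<comment> \<open>Formally, the solution is the sum of (4/9 + 1/(18 v^3)) v^(k+3) over the roots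
    v, with the coefficient \<open>c\<close> found above. Both sides obey the same recurrence, so
    three initial values suffice, and coinciding roots need no separate treatment.\<close>
  have "deltoid_poly z (k + 3) = 4/9 * s (k + 3) + 1/18 * s k"
  proof (induction k rule: nat_induct3)
    case 1
    have "deltoid_poly z 3 = 3/2 * z ^ 3 - 1/2" by (simp add: eval_nat_numeral)
    then show ?case by (simp add: s3 s2 s0) (simp add: eval_nat_numeral field_simps)
  next
    case 2
    have "deltoid_poly z 4 = 9/4 * z ^ 4 - 5/4 * z" by (simp add: eval_nat_numeral algebra_simps)
    then show ?case
      by (simp add: s4 s3 s2 s1[unfolded One_nat_def] s0)
        (simp add: eval_nat_numeral field_simps)
  next
    case 3
    have d5: "deltoid_poly z 5 = 27/8 * z ^ 5 - 19/8 * z\<^sup>2"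
      by (simp add: eval_nat_numeral algebra_simps)
    have t2: "s (Suc (Suc 0)) = 9/4 * z\<^sup>2" using s2 by (simp add: numeral_2_eq_2)
    show ?case
      by (simp add: d5 s5 s4 s3 s2 t2 s1[unfolded One_nat_def] s0)
        (simp add: eval_nat_numeral field_simps)
  next
    case (4 k)
    have d: "deltoid_poly z (Suc (Suc (Suc k)) + 3)
        = 3/2 * z * deltoid_poly z (Suc (Suc k) + 3) - 1/2 * deltoid_poly z (k + 3)"
      unfolding add_Suc deltoid_poly.simps by simp
    have r1: "s (Suc (Suc (Suc k)) + 3) = 3/2 * z * s (Suc (Suc k) + 3) - 1/2 * s (k + 3)"
      using rec[of "k + 3"] by (simp add: eval_nat_numeral)
    have r2: "s (Suc (Suc (Suc k))) = 3/2 * z * s (Suc (Suc k)) - 1/2 * s k"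
      using rec[of k] by (simp add: eval_nat_numeral)
    show ?case unfolding d 4 r1 r2 by (simp add: algebra_simps)
  qed
  then show ?thesis by (simp add: s_def)
qed

lemma deltoid_map_roots:
  fixes z :: complex
  obtains x y w where "x + y + w = 3/2 * z" "x * y + y * w + w * x = 0" "x * y * w = - (1/2)"
    "deltoid_map x = z" "deltoid_map y = z" "deltoid_map w = z"
proof -
  have "\<not> constant (poly [:1/2, 0, -(3/2) * z, 1:])"
    by (simp add: constant_degree)
  then obtain w where w: "poly [:1/2, 0, -(3/2) * z, 1:] w = 0"
    using fundamental_theorem_of_algebra by blast
  then have "w \<noteq> 0" by auto
  with w have z: "z = 2/3 * w + 1/3 / w\<^sup>2"
    by (simp add: field_simps power2_eq_square)
  \<comment> \<open>After splitting off the root \<open>w\<close>, the other two solve t^2 -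
    t/(2w^2) - 1/(2w) = 0; \<open>d\<close> is a square root of its discriminant.\<close>
  define d where "d = csqrt (1 / (4 * w ^ 4) + 2 / w)"
  define x y where "x = (1 / (2 * w\<^sup>2) + d) / 2" and "y = (1 / (2 * w\<^sup>2) - d) / 2"
  have d: "d * d = 1 / (4 * w ^ 4) + 2 / w"
    unfolding d_def by (metis power2_csqrt power2_eq_square)
  have xy: "x + y = 1 / (2 * w\<^sup>2)"
    using \<open>w \<noteq> 0\<close> by (simp add: x_def y_def field_simps)
  have "x * y = (1 / (4 * w ^ 4) - d * d) / 4"
  proof -
    have "(p + d) / 2 * ((p - d) / 2) = (p * p - d * d) / 4" for p by (simp add: algebra_simps)
    then show ?thesis unfolding x_def y_def by (simp add: power2_eq_square power4_eq_xxxx)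
  qed
  also have "\<dots> = - 1 / (2 * w)" unfolding d using \<open>w \<noteq> 0\<close> by (simp add: field_simps)
  finally have p: "x * y = - 1 / (2 * w)" .
  have e1: "x + y + w = 3/2 * z" unfolding xy z using \<open>w \<noteq> 0\<close> by (simp add: field_simps)
  have e2: "x * y + y * w + w * x = 0"
  proof -
    have "x * y + y * w + w * x = x * y + w * (x + y)" by (simp add: algebra_simps)
    then show ?thesis unfolding p xy using \<open>w \<noteq> 0\<close> by (simp add: field_simps power2_eq_square)
  qed
  have e3: "x * y * w = - (1/2)" unfolding p using \<open>w \<noteq> 0\<close> by simp
  have "deltoid_map v = z" if "v \<in> {x,y,w}" for v
  proof -
    have "v \<noteq> 0" using that e3 by auto
    have "(v - x) * (v - y) * (v - w) = 0" using that by auto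
    then have "v ^ 3 - (x + y + w) * v\<^sup>2 + (x * y + y * w + w * x) * v - x * y * w = 0"
      by (simp add: power2_eq_square power3_eq_cube algebra_simps)
    then show ?thesis unfolding e1 e2 e3 deltoid_map_def using \<open>v \<noteq> 0\<close>
      by (simp add: field_simps power2_eq_square power3_eq_cube)
  qed
  with e1 e2 e3 show thesis by (intro that) auto
qed

text \<open>Otherwise the image of the whole exterior of the disc would lie in the bounded component
  containing \<open>deltoid_map w\<close>, although f grows linearly.\<close>

lemma norm_le_1_if_deltoid_map_inside:
  assumes "deltoid_map w \<in> inside (deltoid ` {0..2*pi})"
  shows "norm w \<le> 1"
proof (rule ccontr)
  assume w: "\<not> norm w \<le> 1"
  let ?S = "deltoid_map ` (- cball (0::complex) 1)"
  have "connected (- cball (0::complex) 1)"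
    by (intro connected_complement_bounded_convex) auto
  moreover have "continuous_on (- cball (0::complex) 1) deltoid_map"
    unfolding deltoid_map_def by (intro continuous_intros) auto
  ultimately have "connected ?S" by (rule connected_continuous_image[rotated])
  moreover have "?S \<inter> deltoid ` {0..2*pi} = {}"
  proof (rule ccontr)
    assume "\<not> ?thesis"
    then obtain v t where "\<not> norm v \<le> 1" and dv: "deltoid_map v = deltoid t" by auto
    then have v: "norm v > 1" by simp
    define e where "e = exp (\<i> * complex_of_real t)"
    have e: "norm e = 1" "e \<noteq> 0" by (auto simp: e_def)
    have "exp (- 2 * \<i> * complex_of_real t) = inverse (e\<^sup>2)"
      unfolding e_def exp_minus[symmetric] exp_double[symmetric] by (simp add: algebra_simps)
    then have "deltoid t = deltoid_map e"
      by (simp add: deltoid_def deltoid_map_def e_def inverse_eq_divide)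
    with dv have "deltoid_map v - deltoid_map e = 0" by simp
    moreover have "v \<noteq> 0" "v \<noteq> e" using v e by auto
    \<comment> \<open>Cancelling \<open>v - e\<close> leaves an equation whose two sides have
      incompatible moduli: 2|v|^2 > |v| + 1 when |v| > 1.\<close>
    moreover from this e have "(v - e) * (2 * v\<^sup>2 * e\<^sup>2 - (v + e))
        = 3 * v\<^sup>2 * e\<^sup>2 * (deltoid_map v - deltoid_map e)"
      by (simp add: deltoid_map_def field_simps power2_eq_square)
    ultimately have "2 * v\<^sup>2 * e\<^sup>2 = v + e" by simp
    moreover have "norm (2 * v\<^sup>2 * e\<^sup>2) = 2 * (norm v)\<^sup>2"
      by (simp add: norm_mult norm_power e)
    ultimately have "2 * (norm v)\<^sup>2 = norm (v + e)" by simp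
    also have "\<dots> \<le> norm v + 1" using e norm_triangle_ineq[of v e] by simp
    also have "\<dots> < 2 * (norm v)\<^sup>2"
    proof -
      have "0 < norm v" using v by linarith
      then have "norm v * 1 < norm v * norm v" using v by (intro mult_strict_left_mono)
      then show ?thesis using v unfolding power2_eq_square by linarith
    qed
    finally show False by simp
  qed
  moreover have "deltoid_map w \<in> ?S" using w by auto
  ultimately have "?S \<subseteq> connected_component_set (- deltoid ` {0..2*pi}) (deltoid_map w)"
    by (intro connected_component_maximal) auto
  then have "bounded ?S"
    using assms bounded_subset unfolding inside_def by blast
  then obtain B where "\<forall>x\<in>?S. norm x \<le> B" unfolding bounded_iff by blast
  then have B: "norm (deltoid_map v) \<le> B" if "norm v > 1" for v :: complex
    using that by simp
  \<comment> \<open>Large enough that 2/3 r exceeds \<open>B\<close>, and greater than 1 whatever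
    the sign of \<open>B\<close>.\<close>
  define r where "r = 2 * \<bar>B\<bar> + 2"
  have "r > 1" by (simp add: r_def)
  have "deltoid_map (complex_of_real r) = of_real (2/3 * r + 1/3 / r\<^sup>2)"
    by (simp add: deltoid_map_def)
  then have "norm (deltoid_map (complex_of_real r)) = 2/3 * r + 1/3 / r\<^sup>2"
    using \<open>r > 1\<close> by (simp only: norm_of_real) simp
  moreover have "1/3 / r\<^sup>2 \<ge> 0" by simp
  ultimately have "norm (deltoid_map (complex_of_real r)) \<ge> 2/3 * r" by linarith
  moreover have "norm (deltoid_map (complex_of_real r)) \<le> B"
    using B[of "complex_of_real r"] \<open>r > 1\<close> by simp
  ultimately show False by (simp add: r_def)
qed

lemma continuous_on_deltoid_poly: "continuous_on S (\<lambda>z. deltoid_poly z k)"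
  by (induction k rule: nat_induct3) (auto intro!: continuous_intros)

lemma norm_deltoid_poly_le_inside:
  assumes "z \<in> inside (deltoid ` {0..2*pi})"
  shows "norm (deltoid_poly z (k + 3)) \<le> 3/2"
proof -
  obtain x y w where e: "x + y + w = 3/2 * z" "x * y + y * w + w * x = 0" "x * y * w = - (1/2)"
    and r: "deltoid_map x = z" "deltoid_map y = z" "deltoid_map w = z" by (rule deltoid_map_roots)
  have le: "norm x \<le> 1" "norm y \<le> 1" "norm w \<le> 1"
    using assms r by (auto intro: norm_le_1_if_deltoid_map_inside)
  have s: "norm (x ^ k + y ^ k + w ^ k) \<le> 3" for k
  proof -
    have "norm (x ^ k + y ^ k + w ^ k) \<le> norm (x ^ k) + norm (y ^ k) + norm (w ^ k)"
      by (meson norm_triangle_le norm_triangle_ineq add_right_mono order_trans)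
    then show ?thesis
      using power_le_one[OF norm_ge_zero le(1)] power_le_one[OF norm_ge_zero le(2)]
        power_le_one[OF norm_ge_zero le(3)] by (simp add: norm_power) (smt (verit))
  qed
  \<comment> \<open>Each power sum is at most 3 in modulus, and 3 (4/9 + 1/18) = 3/2.\<close>
  show ?thesis
    unfolding deltoid_poly_power_sums[OF e]
    using norm_triangle_ineq[of "4/9 * (x ^ (k+3) + y ^ (k+3) + w ^ (k+3))"
        "1/18 * (x ^ k + y ^ k + w ^ k)"]
      s[of "k+3"] s[of k] by (simp only: norm_mult) simp
qed

lemma norm_deltoid_poly_le:
  assumes "z \<in> deltoid_region"
  shows "norm (deltoid_poly z (k + 3)) \<le> 3/2"
proof -
  have "closed {z::complex. norm (deltoid_poly z (k + 3)) \<le> 3/2}"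
    by (intro closed_Collect_le continuous_intros continuous_on_deltoid_poly)
  moreover have "inside (deltoid ` {0..2*pi}) \<subseteq> {z. norm (deltoid_poly z (k + 3)) \<le> 3/2}"
    using norm_deltoid_poly_le_inside by blast
  ultimately have "deltoid_region \<subseteq> {z. norm (deltoid_poly z (k + 3)) \<le> 3/2}"
    unfolding deltoid_region_def by (intro closure_minimal)
  then show ?thesis using assms by blast
qed

section \<open>Removing the normalisation from the iteration\<close>

lemma norm_smult_vec: "norm (c *s x) = norm c * norm (x :: complex ^ 'n)"
  by (simp add: norm_vec_def norm_mult L2_set_right_distrib)

lemma scaleR_matrix_vector:
  fixes A :: "complex ^ 'n ^ 'm"
  shows "(c *\<^sub>R A) *v x = c *\<^sub>R (A *v x)" "A *v (c *\<^sub>R x) = c *\<^sub>R (A *v x)"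
  by (simp_all add: matrix_vector_mult_def vec_eq_iff scaleR_sum_right)

text \<open>The linear recurrence for \<open>V\<close> differs from the iterates by the positive
  factor \<open>H k\<close>, the product of all earlier norms. Dividing \<open>\<beta>\<close> by
  two consecutive norms is exactly what makes the momentum term scale like the other one.\<close>

lemma dmpm_eq_sgn:
  assumes V0: "V 0 = complex_vec v" and V1: "V (Suc 0) = (2/3) *\<^sub>R (A *v V 0)"
    and V2: "V (Suc (Suc 0)) = (2/3) *\<^sub>R (A *v V (Suc 0))"
    and V3: "\<And>k. V (Suc (Suc (Suc k))) = A *v V (Suc (Suc k)) - \<beta> *s V k"
    and nz: "\<And>k. V k \<noteq> 0"
  shows "dmpm A v \<beta> N = sgn (V N)"
proof -
  define u where "u = dmpm_u A v \<beta>"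
  define H where "H k = (\<Prod>i<k. norm (u i))" for k
  have sg: "V k = H (Suc k) *\<^sub>R sgn (u k)" if "V k = H k *\<^sub>R u k" for k
    using that by (cases "u k = 0") (simp_all add: H_def sgn_div_norm)
  have b0: "V 0 = H 0 *\<^sub>R u 0" by (simp add: H_def u_def V0)
  have b1: "V (Suc 0) = H (Suc 0) *\<^sub>R u (Suc 0)"
    unfolding V1 sg[OF b0]
    by (simp add: u_def scaleR_matrix_vector)
  have b2: "V (Suc (Suc 0)) = H (Suc (Suc 0)) *\<^sub>R u (Suc (Suc 0))"
    unfolding V2 sg[OF b1]
    by (simp add: u_def scaleR_matrix_vector)
  have "V k = H k *\<^sub>R u k" for k
  proof (induction k rule: nat_induct3)
    case (4 k)
    define n where "n = norm (u (Suc (Suc k))) * norm (u (Suc k))"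
    \<comment> \<open>Needed so that the division by \<open>n\<close> in the momentum term can be
      undone.\<close>
    have "u (Suc k) \<noteq> 0" "u (Suc (Suc k)) \<noteq> 0" using 4 nz by (metis scaleR_zero_right)+
    then have "n \<noteq> 0" by (simp add: n_def)
    have H: "H (Suc (Suc (Suc k))) = H (Suc k) * n" by (simp add: H_def n_def)
    have "V (Suc (Suc (Suc k))) = A *v (H (Suc (Suc (Suc k))) *\<^sub>R sgn (u (Suc (Suc k))))
       - \<beta> *s (H (Suc k) *\<^sub>R sgn (u k))"
      using V3 sg 4 by simp
    also have "\<beta> *s (H (Suc k) *\<^sub>R sgn (u k))
        = H (Suc (Suc (Suc k))) *\<^sub>R ((\<beta> / of_real n) *s sgn (u k))"
      unfolding H using \<open>n \<noteq> 0\<close> by (simp add: vec_eq_iff) (simp add: scaleR_conv_of_real)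
    also have "A *v (H (Suc (Suc (Suc k))) *\<^sub>R sgn (u (Suc (Suc k))))
        - H (Suc (Suc (Suc k))) *\<^sub>R ((\<beta> / of_real n) *s sgn (u k))
        = H (Suc (Suc (Suc k))) *\<^sub>R u (Suc (Suc (Suc k)))"
      by (simp add: u_def n_def scaleR_matrix_vector scaleR_diff_right)
    finally show ?case .
  qed (fact b0 b1 b2)+
  from this[of N] nz[of N] have "V N = H N *\<^sub>R u N" "H N \<noteq> 0" by auto
  moreover have "H N \<ge> 0" by (simp add: H_def prod_nonneg)
  ultimately show ?thesis by (simp add: dmpm_def u_def sgn_scaleR)
qed

text \<open>The phase of \<open>c\<close> serves as the angle. One \<open>norm e\<close> pays for
  the perturbation, the other for normalising \<open>f + e\<close>, whose norm differs from 1 by at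
  most \<open>norm e\<close>.\<close>

lemma phase_dist_sgn_le:
  assumes "norm f = 1" "c \<noteq> 0"
  shows "phase_dist (sgn (c *s (f + e))) f \<le> 2 * norm e"
proof -
  have s: "sgn (c *s x) = sgn c *s sgn x" for x :: "complex ^ 'n"
    by (simp add: sgn_div_norm norm_smult_vec vec_eq_iff)
  have "of_real (norm c) * sgn c = c"
    using assms(2) by (simp add: sgn_div_norm scaleR_conv_of_real)
  also have "c = of_real (norm c) * exp (\<i> * complex_of_real (Arg2pi c))"
    by (rule Arg2pi_eq)
  finally have t: "sgn c = exp (\<i> * complex_of_real (Arg2pi c))"
    using assms(2) by simp
  have "Arg2pi c \<in> {0..<2*pi}" by (simp add: Arg2pi_ge_0 Arg2pi_lt_2pi)
  then have "phase_dist (sgn (c *s (f + e))) f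
      \<le> norm (sgn (c *s (f + e)) - exp (\<i> * complex_of_real (Arg2pi c)) *s f)"
    using phase_dist_attained[of "sgn (c *s (f + e))" f] by blast
  also have "\<dots> = norm (sgn c *s sgn (f + e) - sgn c *s f)"
    by (simp only: s t)
  also have "\<dots> = norm (sgn c *s (sgn (f + e) - f))"
    by (simp only: vector_ssub_ldistrib)
  also have "\<dots> = norm (sgn (f + e) - f)"
    using assms(2) by (simp only: norm_smult_vec norm_sgn) simp
  also have "\<dots> \<le> norm (sgn (f + e) - (f + e)) + norm e"
    using norm_triangle_ineq[of "sgn (f + e) - (f + e)" e] by simp
  also have "norm (sgn (f + e) - (f + e)) \<le> norm e"
  proof -
    have "norm (sgn y - y) \<le> \<bar>norm y - norm f\<bar>" for y :: "complex ^ 'n"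
    proof (cases "y = 0")
      case False
      have "norm y *\<^sub>R sgn y = y" using False by (simp add: sgn_div_norm)
      then have "sgn y - y = (1 - norm y) *\<^sub>R sgn y" by (simp add: scaleR_diff_left)
      then show ?thesis using False assms(1) by (simp add: norm_sgn)
    qed simp
    also have "\<bar>norm (f + e) - norm f\<bar> \<le> norm e"
      using norm_triangle_ineq3[of "f + e" f] by simp
    finally show ?thesis .
  qed
  finally show ?thesis by simp
qed

section \<open>Expansion in the eigenbasis and the convergence rate\<close>

lemma sum_smult_eq_0:
  assumes "diagonalized_by A lam (phi :: nat \<Rightarrow> complex ^ 'n)"
    and "(\<Sum>j = 1..CARD('n). c j *s phi j) = 0"
    and "j \<in> {1..CARD('n)}"
  shows "c j = 0"
proof -
  let ?I = "{1..CARD('n)}"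
  have inj: "inj_on phi ?I" and ind: "vec.independent (phi ` ?I)"
    using assms(1) by (auto simp: diagonalized_by_def)
  \<comment> \<open>Independence concerns the set of eigenvectors, so the coefficients are reindexed
    by vectors.\<close>
  have "(\<Sum>x\<in>phi ` ?I. c (inv_into ?I phi x) *s x)
      = (\<Sum>j\<in>?I. c (inv_into ?I phi (phi j)) *s phi j)"
    by (simp only: sum.reindex[OF inj] o_def)
  also have "\<dots> = (\<Sum>j\<in>?I. c j *s phi j)"
    by (intro sum.cong) (simp_all only: inv_into_f_f[OF inj])
  finally have "(\<Sum>x\<in>phi ` ?I. c (inv_into ?I phi x) *s x) = 0"
    using assms(2) by simp
  then have "c (inv_into ?I phi (phi j)) = 0"
    using vec.independentD[OF ind, of "phi ` ?I" "\<lambda>x. c (inv_into ?I phi x)" "phi j"] assms(3) by auto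
  then show ?thesis using assms(3) inj by simp
qed

lemma mult_sum_eigen:
  assumes "diagonalized_by A lam (phi :: nat \<Rightarrow> complex ^ 'n)"
  shows "A *v (\<Sum>j = 1..CARD('n). c j *s phi j) = (\<Sum>j = 1..CARD('n). (lam j * c j) *s phi j)"
proof -
  have "A *v (\<Sum>j = 1..CARD('n). c j *s phi j) = (\<Sum>j = 1..CARD('n). c j *s (A *v phi j))"
    by (simp add: vec.linear_sum[OF matrix_vector_mul_linear_gen] vector_scalar_commute)
  also have "\<dots> = (\<Sum>j = 1..CARD('n). (lam j * c j) *s phi j)"
    using assms by (intro sum.cong) (auto simp: diagonalized_by_def mult.commute)
  finally show ?thesis .
qed

lemma sum_split_first: "(\<Sum>j = 1..CARD('n::finite). f j) = f 1 + (\<Sum>j = 2..CARD('n). f j)"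
  for f :: "nat \<Rightarrow> 'b::comm_monoid_add"
  using sum.atLeast_Suc_atMost[of 1 "CARD('n)" f] by (simp add: Suc_le_eq numeral_2_eq_2)

text \<open>Choosing \<open>C\<close> and the threshold before the matrix, eigendata and
  \<open>lam_star\<close> expresses that the constant depends only on the coefficients
  \<open>a\<close>.\<close>

theorem theorem4:
  fixes a :: "nat \<Rightarrow> complex"
  assumes "a 1 \<noteq> 0"
  shows "\<exists>C > 0. \<exists>N\<^sub>0. \<forall>(A :: complex ^ 'n ^ 'n) (lam :: nat \<Rightarrow> complex) (phi :: nat \<Rightarrow> complex ^ 'n)
           (lam_star :: complex) (v\<^sub>0 :: real ^ 'n).
      diagonalized_by A lam phi \<longrightarrow>
      (\<forall>j\<in>{2..CARD('n)}. norm (lam 1) > norm (lam j)) \<longrightarrow>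
      (\<forall>i\<in>{2..CARD('n)}. \<forall>j\<in>{i..CARD('n)}. norm (lam i) \<ge> norm (lam j)) \<longrightarrow>
      lam_star \<noteq> 0 \<longrightarrow>
      norm lam_star < norm (lam 1) \<longrightarrow>
      (\<forall>j\<in>{2..CARD('n)}. lam j \<in> (\<lambda>z. lam_star * z) ` deltoid_region) \<longrightarrow>
      complex_vec v\<^sub>0 = (\<Sum>j = 1..CARD('n). a j *s phi j) \<longrightarrow>
      (\<forall>N\<ge>N\<^sub>0. phase_dist (dmpm A v\<^sub>0 (4 * lam_star ^ 3 / 27) N) (phi 1)
                \<le> C * (1 + sqrt (norm (lam 1 / lam_star) - 1)) powi (- int N))"
proof -
  define S where "S = (\<Sum>j = 2..CARD('n). norm (a j / a 1))"
  have S: "S \<ge> 0" by (simp add: S_def sum_nonneg)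
  show ?thesis
  \<comment> \<open>27/4 is twice the quotient of 3/2 by 4/9; the summand 1 keeps the constant
    positive when \<open>S = 0\<close>. The upper bound starts at index 3.\<close>
  proof (intro exI[of _ "27/4 * S + 1"] exI[of _ 3] conjI allI impI)
    fix A :: "complex ^ 'n ^ 'n" and lam :: "nat \<Rightarrow> complex" and phi :: "nat \<Rightarrow> complex ^ 'n"
      and l :: complex and v :: "real ^ 'n" and N :: nat
    assume diag: "diagonalized_by A lam phi" and l: "l \<noteq> 0" "norm l < norm (lam 1)"
      and region: "\<forall>j\<in>{2..CARD('n)}. lam j \<in> (\<lambda>z. l * z) ` deltoid_region"
      and v: "complex_vec v = (\<Sum>j = 1..CARD('n). a j *s phi j)" and N: "N \<ge> 3"
    define W where "W = 1 + sqrt (norm (lam 1 / l) - 1)"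
    \<comment> \<open>The factor 2l/3 undoes the scaling: (3/2)(2/3) = 1 restores the eigenvalue,
      and (1/2)(2l/3)^3 = 4l^3/27 is the momentum parameter.\<close>
    define c where "c k j = a j * (2/3 * l) ^ k * deltoid_poly (lam j / l) k" for k j
    define V where "V k = (\<Sum>j = 1..CARD('n). c k j *s phi j)" for k
    have one: "1 \<in> {1..CARD('n)}" by (simp add: Suc_le_eq)
    have z1: "norm (lam 1 / l) \<ge> 1" using l by (simp add: norm_divide)
    then have W: "W \<ge> 1" by (simp add: W_def)
    have lower: "norm (deltoid_poly (lam 1 / l) k) \<ge> 4/9 * W ^ k" for k
      using norm_deltoid_poly_ge[OF z1] by (simp add: W_def)
    have pos: "norm (deltoid_poly (lam 1 / l) k) > 0" for k
      using lower[of k] W by (smt (verit) divide_pos_pos mult_pos_pos zero_less_power)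
    then have c1: "c k 1 \<noteq> 0" for k using assms l by (simp add: c_def)
    then have nz: "V k \<noteq> 0" for k
      using sum_smult_eq_0[OF diag, of "c k" 1] one by (auto simp: V_def)
    have "dmpm A v (4 * l ^ 3 / 27) N = sgn (V N)"
    proof (rule dmpm_eq_sgn)
      show "V 0 = complex_vec v" by (simp add: V_def c_def v)
      show "V (Suc 0) = (2/3) *\<^sub>R (A *v V 0)" "V (Suc (Suc 0)) = (2/3) *\<^sub>R (A *v V (Suc 0))"
        unfolding V_def mult_sum_eigen[OF diag] scaleR_sum_right using l
        by (auto intro!: sum.cong simp: c_def vec_eq_iff power2_eq_square)
          (simp_all add: scaleR_conv_of_real)
      show "V (Suc (Suc (Suc k))) = A *v V (Suc (Suc k)) - (4 * l ^ 3 / 27) *s V k" for k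
      proof -
        have "c (Suc (Suc (Suc k))) j = lam j * c (Suc (Suc k)) j - 4 * l ^ 3 / 27 * c k j" for j
          using l by (simp add: c_def field_simps power3_eq_cube)
        then show ?thesis
          unfolding V_def mult_sum_eigen[OF diag] vec.scale_sum_right
          by (simp add: vector_sub_rdistrib sum_subtractf vector_smult_assoc)
      qed
    qed (rule nz)
    moreover define e where "e = (\<Sum>j = 2..CARD('n). (c N j / c N 1) *s phi j)"
    have "V N = c N 1 *s (phi 1 + e)"
      using c1[of N]
      unfolding V_def e_def sum_split_first
      by (simp add: vector_add_ldistrib vec.scale_sum_right vector_smult_assoc)
    ultimately have "phase_dist (dmpm A v (4 * l ^ 3 / 27) N) (phi 1) \<le> 2 * norm e"
      using phase_dist_sgn_le[of "phi 1" "c N 1" e] diag one c1[of N]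
      by (auto simp: diagonalized_by_def)
    also have "norm e \<le> (\<Sum>j = 2..CARD('n). norm (a j / a 1) * (27/8 * inverse (W ^ N)))"
      unfolding e_def
    proof (rule sum_norm_le)
      fix j assume j: "j \<in> {2..CARD('n)}"
      then obtain z where z: "z \<in> deltoid_region" "lam j = l * z" using region by blast
      have "norm (deltoid_poly z N) \<le> 3/2"
        using norm_deltoid_poly_le[OF z(1), of "N - 3"] N by simp
      then have "norm (deltoid_poly z N) / norm (deltoid_poly (lam 1 / l) N)
          \<le> (3/2) / (4/9 * W ^ N)"
        using lower[of N] W by (intro frac_le) auto
      also have "\<dots> = 27/8 * inverse (W ^ N)" by (simp add: field_simps)
      finally have "norm (deltoid_poly z N) / norm (deltoid_poly (lam 1 / l) N)
          \<le> 27/8 * inverse (W ^ N)" .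
      then have "norm (a j / a 1) * (norm (deltoid_poly z N) / norm (deltoid_poly (lam 1 / l) N))
          \<le> norm (a j / a 1) * (27/8 * inverse (W ^ N))"
        by (rule mult_left_mono) simp
      \<comment> \<open>The common power of 2l/3 cancels, so only the quotient of polynomial values
        governs the rate.\<close>
      moreover have "c N j / c N 1 = a j / a 1 * (deltoid_poly z N / deltoid_poly (lam 1 / l) N)"
        using l by (simp add: c_def z)
      moreover have "norm (phi j) = 1" using diag j by (auto simp: diagonalized_by_def)
      ultimately show "norm ((c N j / c N 1) *s phi j) \<le> norm (a j / a 1) * (27/8 * inverse (W ^ N))"
        by (simp only: norm_smult_vec norm_mult norm_divide mult_1_right)
    qed
    also have "2 * (\<Sum>j = 2..CARD('n). norm (a j / a 1) * (27/8 * inverse (W ^ N)))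
        = 27/4 * S * inverse (W ^ N)"
      by (simp only: S_def sum_distrib_right[symmetric])
    also have "\<dots> \<le> (27/4 * S + 1) * inverse (W ^ N)"
      using W by (intro mult_right_mono) auto
    also have "inverse (W ^ N) = W powi (- int N)"
      by (simp add: power_int_minus)
    finally show "phase_dist (dmpm A v (4 * l ^ 3 / 27) N) (phi 1)
        \<le> (27/4 * S + 1) * (1 + sqrt (norm (lam 1 / l) - 1)) powi (- int N)"
      by (simp add: W_def)
  qed (use S in auto)
qed

end
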